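(* Let $n\ge 0$. Let $\mathcal{G}_n^{[-1,1]}$ be the set of GDAP of length $n$ all of whose vertices have ordinate in $\{-1,0,1\}$, and let $\mathcal{C}'(n+3)$ be the set of compositions of $n+3$ (ordered sequences of positive integers summing to $n+3$) whose first part is odd, whose last part is even, and in which no two consecutive parts have the same parity. Define $\phi:\mathcal{G}_n^{[-1,1]}\to\mathcal{C}'(n+3)$ as follows. For the empty path, $\phi(\varepsilon)=(1,2)$. For nonempty $\alpha$, if $\alpha$ contains neither the factor $UU$ nor the factor $UD_2$ (equivalently $\alpha=(UD)^{n/2}$ or $\alpha=(DU)^{n/2}$ with $n$ even), set $\phi((UD)^{n/2})=(n+1,2)$ and $\phi((DU)^{n/2})=(1,n+2)$. Otherwise write $\alpha=B_1B_2\cdots B_r$ (with $r\ge 2$) by cutting $\alpha$ immediately after each up-step that is followed by another up-step or by a $D_2$-step, let $b_i$ be the length of $B_i$, and let $L$ be the reversed sequence $(b_r,b_{r-1},\dots,b_1)$. Then modify $L$ as follows: if $b_{r-1}$ is even, add $1$ to the entry $b_r$, otherwise prepend a part $1$ at the beginning of $L$; then, if $b_1$ is even, add $2$ to the entry $b_1$, otherwise append a part $2$ at the end of $L$. The resulting sequence is $\phi(\alpha)$. Then $\phi$ is a bijection from $\mathcal{G}_n^{[-1,1]}$ onto $\mathcal{C}'(n+3)$.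
   Context: A grand Dyck path with air pockets (GDAP) is a lattice path in $\mathbb{Z}^2$ starting at $(0,0)$ and ending on the $x$-axis, consisting of up-steps $U=(1,1)$ and down-steps $D_k=(1,-k)$ with $k\ge 1$, such that no two down-steps are consecutive; the path may go below the $x$-axis, and the empty path $\varepsilon$ is a GDAP. The length of a path is its number of steps; $D$ denotes $D_1$. *)

theory Defs
  imports Main "HOL-Library.Sublist"
begin

text \<open>
  A path starting at the origin is represented by its list of steps; \<open>U\<close> is the step (1,1)
  and \<open>D k\<close> the step (1,-k). The condition \<open>k \<ge> 1\<close> is part of \<open>gdap\<close> below.
\<close>

datatype step = U | D nat

fun rise :: "step \<Rightarrow> int" where
  "rise U = 1"
| "rise (D k) = - int k"

definition ordinate :: "step list \<Rightarrow> nat \<Rightarrow> int" where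
  "ordinate p i = sum_list (map rise (take i p))"

definition gdap :: "step list \<Rightarrow> bool" where
  "gdap p \<longleftrightarrow>
     (\<forall>k. D k \<in> set p \<longrightarrow> k \<ge> 1) \<and>
     successively (\<lambda>s t. \<not> (s \<noteq> U \<and> t \<noteq> U)) p \<and>
     ordinate p (length p) = 0"

definition gdap_band :: "nat \<Rightarrow> step list set" where
  "gdap_band n =
     {p. gdap p \<and> length p = n \<and> (\<forall>i \<le> length p. ordinate p i \<in> {-1, 0, 1})}"

definition compositions :: "nat \<Rightarrow> nat list set" where
  "compositions m = {c. (\<forall>x \<in> set c. x > 0) \<and> sum_list c = m}"

definition alternating_compositions :: "nat \<Rightarrow> nat list set" where
  "alternating_compositions m =
     {c \<in> compositions m. c \<noteq> [] \<and> odd (hd c) \<and> even (last c) \<and>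
        successively (\<lambda>x y. even x \<noteq> even y) c}"

text \<open>The blocks \<open>B\<^sub>1, \<dots>, B\<^sub>r\<close>: cut after each \<open>U\<close> that is followed by \<open>U\<close> or \<open>D 2\<close>.\<close>

fun blocks :: "step list \<Rightarrow> step list list" where
  "blocks [] = []"
| "blocks [s] = [[s]]"
| "blocks (s # t # p) =
     (if s = U \<and> (t = U \<or> t = D 2)
      then [s] # blocks (t # p)
      else (s # hd (blocks (t # p))) # tl (blocks (t # p)))"

text \<open>
  The general case. List indices start at 0, so \<open>b ! 0\<close> is \<open>b\<^sub>1\<close> and \<open>b ! (r - 2)\<close> is
  \<open>b\<^sub>r\<^sub>-\<^sub>1\<close>; since \<open>r \<ge> 2\<close>, the last entry of \<open>L'\<close> is still \<open>b\<^sub>1\<close>.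
\<close>

definition phi_blocks :: "step list \<Rightarrow> nat list" where
  "phi_blocks p =
     (let b = map length (blocks p);
          r = length b;
          L = rev b;
          L' = (if even (b ! (r - 2)) then (hd L + 1) # tl L else 1 # L)
      in if even (b ! 0) then butlast L' @ [last L' + 2] else L' @ [2])"

text \<open>
  A nonempty path of \<open>gdap_band n\<close> with neither factor \<open>U U\<close> nor \<open>U (D 2)\<close> is
  \<open>(U (D 1))\<^sup>n\<^sup>/\<^sup>2\<close> or \<open>((D 1) U)\<^sup>n\<^sup>/\<^sup>2\<close>; the inner conditional tells these two apart.
\<close>

definition phi :: "step list \<Rightarrow> nat list" where
  "phi p =
     (let n = length p in
      if p = [] then [1, 2]
      else if \<not> sublist [U, U] p \<and> \<not> sublist [U, D 2] p then
        (if p = concat (replicate (n div 2) [U, D 1]) then [n + 1, 2] else [1, n + 2])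
      else phi_blocks p)"

end

theory Submission
  imports Defs
begin

text \<open>
  For \<open>p\<close> in the band, the cuts of the extended path \<open>D\<^sub>2 U p U\<close> absorb all the case distinctions
  in the definition of \<open>\<phi>\<close>: reversing the sequence of its block lengths gives \<open>\<phi> p\<close>, and the sum
  of the lengths is \<open>n + 3\<close>. These extended paths run from height 1 to height 1, and an extended
  path is recovered from its block lengths, since a block of odd length is \<open>(UD)\<^sup>kU\<close> (from height
  0 to 1) and a block of even length is \<open>D\<^sub>2U(DU)\<^sup>k\<close> (from height 1 to 0). Hence the block lengths
  are arbitrary positive integers of alternating parity, the first even and the last odd.
\<close>

section \<open>Zigzags, blocks and admissible paths\<close>

fun zigzag :: "nat \<Rightarrow> step list" where
  "zigzag 0 = []"
| "zigzag (Suc 0) = [U]"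
| "zigzag (Suc (Suc k)) = U # D 1 # zigzag k"

text \<open>At \<open>b = 0\<close> the value is \<open>[D 2]\<close>, so length and last step come
  out right only for positive \<open>b\<close>.\<close>

definition block :: "nat \<Rightarrow> step list" where
  "block b = (if odd b then zigzag b else D 2 # zigzag (b - 1))"

definition parity_alternating :: "nat list \<Rightarrow> bool" where
  "parity_alternating bs \<longleftrightarrow> (\<forall>b \<in> set bs. b > 0) \<and> successively (\<lambda>x y. even x \<noteq> even y) bs"

text \<open>The starting height is a parameter so that suffixes of a path are covered; the final
  height 1 is that of the extended path. Down-steps \<open>D k\<close> with \<open>k \<ge> 3\<close>
  are excluded by the band.\<close>

fun admissible :: "int \<Rightarrow> step list \<Rightarrow> bool" where
  "admissible h [] \<longleftrightarrow> h = 1"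
| "admissible h (s # p) \<longleftrightarrow>
     h \<in> {-1, 0, 1} \<and> s \<noteq> D 0 \<and> (s \<noteq> U \<longrightarrow> p = [] \<or> hd p = U) \<and> admissible (h + rise s) p"

lemma length_zigzag [simp]: "length (zigzag k) = k"
  by (induction k rule: zigzag.induct) auto

lemma zigzag_eq_Nil_iff [simp]: "zigzag k = [] \<longleftrightarrow> k = 0"
  by (cases k rule: zigzag.cases) auto

lemma hd_zigzag: "k > 0 \<Longrightarrow> hd (zigzag k) = U"
  by (cases k rule: zigzag.cases) auto

lemma last_zigzag: "odd k \<Longrightarrow> last (zigzag k) = U"
  by (induction k rule: zigzag.induct) (auto simp: odd_pos)

lemma zigzag_Suc_even: "even k \<Longrightarrow> zigzag (Suc k) = zigzag k @ [U]"
  by (induction k rule: zigzag.induct) auto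

lemma concat_replicate_UD: "concat (replicate k [U, D 1]) = zigzag (2 * k)"
  by (induction k) auto

section \<open>Cuts and block decompositions\<close>

lemma blocks_zigzag: "k > 0 \<Longrightarrow> blocks (zigzag k) = [zigzag k]"
proof (induction k rule: zigzag.induct)
  case (3 k)
  then show ?case by (cases k rule: zigzag.cases) auto
qed auto

lemma blocks_D_zigzag: "blocks (D d # zigzag k) = [D d # zigzag k]"
  using blocks_zigzag[of k] by (cases k rule: zigzag.cases) auto

lemma blocks_eq_Nil_iff [simp]: "blocks p = [] \<longleftrightarrow> p = []"
  by (cases p rule: blocks.cases) auto

text \<open>Whether a cut is made depends only on the two adjacent steps, so a cut at the joint
  leaves the cuts on either side unchanged.\<close>

lemma blocks_append:
  "xs \<noteq> [] \<Longrightarrow> ys \<noteq> [] \<Longrightarrow> last xs = U \<Longrightarrow> hd ys = U \<or> hd ys = D 2 \<Longrightarrow>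
     blocks (xs @ ys) = blocks xs @ blocks ys"
proof (induction xs rule: blocks.induct)
  case (2 s)
  then show ?case by (cases ys) auto
qed auto

text \<open>A proposed decomposition is correct once every joint is a cut and no piece has a cut
  inside.\<close>

lemma blocks_concat:
  assumes "successively (\<lambda>x y. last x = U \<and> (hd y = U \<or> hd y = D 2)) B"
    and "\<And>x. x \<in> set B \<Longrightarrow> blocks x = [x]"
  shows "blocks (concat B) = B"
  using assms
proof (induction B rule: induct_list012)
  case (3 x y B)
  \<comment> \<open>\<open>blocks x = [x]\<close> excludes \<open>x = []\<close>, since
    \<open>blocks [] = []\<close>.\<close>
  have ne: "x \<noteq> []" "y \<noteq> []"
    using 3(4)[of x] 3(4)[of y] by auto
  have "blocks (concat (x # y # B)) = blocks (x @ concat (y # B))"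
    by simp
  also have "\<dots> = blocks x @ blocks (concat (y # B))"
    using 3(3) ne by (intro blocks_append) auto
  also have "blocks (concat (y # B)) = y # B"
    using 3(3,4) by (intro 3(2)) auto
  finally show ?case using 3(4) by simp
qed auto

lemma blocks_block: "b > 0 \<Longrightarrow> blocks (block b) = [block b]"
  by (auto simp: block_def blocks_zigzag blocks_D_zigzag odd_pos)

lemma length_block: "b > 0 \<Longrightarrow> length (block b) = b"
  by (auto simp: block_def)

lemma hd_block: "b > 0 \<Longrightarrow> hd (block b) = (if odd b then U else D 2)"
  by (auto simp: block_def hd_zigzag)

lemma last_block: "b > 0 \<Longrightarrow> last (block b) = U"
  by (auto simp: block_def last_zigzag)

lemma map_length_block:
  "parity_alternating bs \<Longrightarrow> map length (map block bs) = bs"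
  by (induction bs) (auto simp: parity_alternating_def length_block successively_Cons)

lemma parity_alternating_Cons:
  "parity_alternating (b # bs) \<longleftrightarrow>
     b > 0 \<and> (bs = [] \<or> (even b \<longleftrightarrow> odd (hd bs))) \<and> parity_alternating bs"
  by (auto simp: parity_alternating_def successively_Cons)

lemma parity_alternating_append:
  "parity_alternating (as @ bs) \<longleftrightarrow>
     parity_alternating as \<and> parity_alternating bs \<and>
     (as = [] \<or> bs = [] \<or> (even (last as) \<longleftrightarrow> odd (hd bs)))"
  by (auto simp: parity_alternating_def successively_append_iff)

lemma successively_block:
  "(\<forall>b \<in> set bs. b > 0) \<Longrightarrow>
     successively (\<lambda>x y. last x = U \<and> (hd y = U \<or> hd y = D 2)) (map block bs)"
  by (induction bs rule: induct_list012) (auto simp: last_block hd_block)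

section \<open>Evaluating \<open>phi\<close> from block lengths\<close>

lemma two_le_length_blocks_iff:
  "length (blocks p) \<ge> 2 \<longleftrightarrow> sublist [U, U] p \<or> sublist [U, D 2] p"
proof (induction p rule: blocks.induct)
  case (3 s t p)
  \<comment> \<open>A factor of length two lies at the front, where it is exactly a cut, or in the
    tail.\<close>
  have *: "sublist [U, v] (s # t # p) \<longleftrightarrow> (s = U \<and> t = v) \<or> sublist [U, v] (t # p)" for v
    by (auto simp: sublist_Cons_right)
  have "blocks (t # p) \<noteq> []" by simp
  then show ?case
    using 3 unfolding * by (cases "blocks (t # p)") auto
qed (auto simp: sublist_Cons_right)

lemma phi_short:
  assumes "p \<noteq> []" "length (blocks p) < 2"
  shows "phi p = (if p = zigzag (2 * (length p div 2)) then [length p + 1, 2] else [1, length p + 2])"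
  using assms two_le_length_blocks_iff[of p]
  unfolding phi_def concat_replicate_UD Let_def by auto

lemma phi_long:
  assumes "length (blocks p) \<ge> 2"
  shows "phi p = phi_blocks p"
  using assms two_le_length_blocks_iff[of p] by (auto simp: phi_def Let_def)

text \<open>\<open>B\<close> lists the blocks of the extended path after the added steps are
  removed: the first block loses \<open>D 2, U\<close>, the last one \<open>U\<close>, and they
  vanish if \<open>e = 2\<close> or \<open>c = 1\<close>. For \<open>r \<ge> 2\<close> the
  alternation makes \<open>b_1\<close> even exactly if \<open>e \<noteq> 2\<close> and
  \<open>b_{r-1}\<close> even exactly if \<open>c \<noteq> 1\<close>, so the parity tests in
  \<open>phi\<close> restore what was removed.\<close>

lemma phi_stripped:
  fixes e c :: nat and mid :: "nat list"
  assumes alt: "parity_alternating (e # mid @ [c])" and "even e" "odd c"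
  defines "B \<equiv> (if e = 2 then [] else [D 1 # zigzag (e - 3)]) @ map block mid @
                (if c = 1 then [] else [zigzag (c - 1)])"
  shows "phi (concat B) = c # rev mid @ [e]"
proof -
  have mid: "parity_alternating mid" and pos: "e > 0" "c > 0" "\<forall>b \<in> set mid. b > 0"
    and ends: "mid \<noteq> [] \<Longrightarrow> odd (hd mid)" "mid \<noteq> [] \<Longrightarrow> even (last mid)"
    using alt assms(2,3)
    by (auto simp: parity_alternating_Cons parity_alternating_append)
       (auto simp: parity_alternating_def)
  have e: "e = 2 \<or> e \<ge> 4" and c: "c = 1 \<or> c \<ge> 3"
    using \<open>even e\<close> \<open>odd c\<close> pos by presburger+
  have B: "blocks (concat B) = B"
  proof (rule blocks_concat)
    have "hd (map block mid) = block (hd mid)" "last (map block mid) = block (last mid)"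
      if "mid \<noteq> []" using that by (simp_all add: hd_map last_map)
    \<comment> \<open>An odd zigzag ends in \<open>U\<close>, so the shortened first block can be
      followed by a cut.\<close>
    moreover have "odd (e - 3)" if "e \<noteq> 2" using that e \<open>even e\<close> by auto
    ultimately show "successively (\<lambda>x y. last x = U \<and> (hd y = U \<or> hd y = D 2)) B"
      using successively_block[OF pos(3)] e c pos
      by (auto simp: B_def successively_append_iff successively_Cons hd_zigzag last_zigzag
            hd_append hd_block last_block)
  next
    fix x assume "x \<in> set B"
    then show "blocks x = [x]"
      using pos c by (auto simp: B_def blocks_block blocks_zigzag blocks_D_zigzag split: if_splits)
  qed
  have lens: "map length B = (if e = 2 then [] else [e - 2]) @ mid @ (if c = 1 then [] else [c - 1])"
    using e map_length_block[OF mid] by (auto simp: B_def)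
  show ?thesis
  proof (cases "length B \<ge> 2")
    case True
    have "phi_blocks (concat B) = c # rev mid @ [e]"
    proof (cases "mid = []")
      case True
      with \<open>length B \<ge> 2\<close> have "e \<noteq> 2" "c \<noteq> 1" by (auto simp: B_def split: if_splits)
      \<comment> \<open>Here \<open>r = 2\<close>, and both parity tests look at the same entry
        \<open>e - 2\<close>.\<close>
      then show ?thesis
        using True e c \<open>even e\<close> by (auto simp: phi_blocks_def B lens Let_def)
    next
      case False
      obtain x m where xm: "mid = x # m" using False by (cases mid) auto
      with ends have "odd x" by auto
      with xm ends have "m \<noteq> []" by (auto split: if_splits)
      then obtain m' y where my: "m = m' @ [y]" by (cases m rule: rev_cases) auto
      have "even y" "odd (last (x # m'))"
        using mid ends xm my by (auto simp: parity_alternating_Cons parity_alternating_append)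
      \<comment> \<open>Counted from \<open>x\<close>, index \<open>length m'\<close> is the entry
        just before \<open>y\<close>. For \<open>c = 1\<close> this is \<open>b_{r-1}\<close>; being
        odd, it causes a 1 to be prepended.\<close>
      then have nth: "odd ((x # m' @ zs) ! length m')" for zs
        by (cases m' rule: rev_cases) (auto simp: nth_append)
      show ?thesis
        using e c \<open>even e\<close> \<open>odd x\<close> \<open>even y\<close> nth[of "[y]"]
        by (cases "e = 2"; cases "c = 1")
           (auto simp: phi_blocks_def B lens Let_def xm my nth_append nth_Cons' butlast_append)
    qed
    then show ?thesis using True by (simp add: phi_long B)
  next
    case False
    \<comment> \<open>A nonempty \<open>mid\<close> starts odd and ends even, so it alone would
      contribute two blocks.\<close>
    have "mid = []"
    proof (rule ccontr)
      assume "mid \<noteq> []"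
      moreover have "length mid \<le> 1" using False by (simp add: B_def split: if_splits)
      ultimately show False using ends by (cases mid) auto
    qed
    with False have "e = 2 \<or> c = 1" by (auto simp: B_def split: if_splits)
    \<comment> \<open>In order: the empty path, a power of \<open>UD\<close>, a power of
      \<open>DU\<close>.\<close>
    then consider "e = 2" "c = 1" | "e = 2" "c \<ge> 3" | "e \<ge> 4" "c = 1"
      using e c by linarith
    then show ?thesis
    proof cases
      case 1
      then show ?thesis using \<open>mid = []\<close> by (simp add: B_def phi_def)
    next
      case 2
      then have "concat B = zigzag (c - 1)" "2 * ((c - 1) div 2) = c - 1"
        using \<open>mid = []\<close> \<open>odd c\<close> by (auto simp: B_def)
      then show ?thesis
        using False B 2 \<open>mid = []\<close> by (subst phi_short) auto
    next
      case 3
      then have p: "concat B = D 1 # zigzag (e - 3)"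
        using \<open>mid = []\<close> by (auto simp: B_def)
      have "D 1 # xs \<noteq> zigzag k" for xs k
        by (cases k rule: zigzag.cases) auto
      then show ?thesis
        using False B 3 \<open>mid = []\<close> p by (subst phi_short) auto
    qed
  qed
qed

text \<open>Cancelling the three added steps against the first and last block leaves the list
  \<open>B\<close> of \<open>phi_stripped\<close>.\<close>

lemma phi_eq_rev:
  assumes alt: "parity_alternating bs" "bs \<noteq> []" "even (hd bs)" "odd (last bs)"
    and p: "D 2 # U # p @ [U] = concat (map block bs)"
  shows "phi p = rev bs"
proof -
  obtain e m where em: "bs = e # m" using alt by (cases bs) auto
  with alt have "m \<noteq> []" by (auto split: if_splits)
  then obtain mid c where bs: "bs = e # mid @ [c]" using em by (cases m rule: rev_cases) auto
  have ec: "even e" "odd c" "e > 0" using alt by (auto simp: bs parity_alternating_def)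
  then have e: "e = 2 \<or> e \<ge> 4" and c: "c = 1 \<or> c \<ge> 3" by presburger+
  have "block e = D 2 # U # concat (if e = 2 then [] else [D 1 # zigzag (e - 3)])"
  proof (cases "e = 2")
    case False
    then have "e - 1 = Suc (Suc (e - 3))" using e by auto
    then show ?thesis using ec False by (simp add: block_def)
  qed (simp add: block_def)
  moreover have "block c = concat (if c = 1 then [] else [zigzag (c - 1)]) @ [U]"
    using ec c zigzag_Suc_even[of "c - 1"] by (auto simp: block_def)
  ultimately have "p = concat ((if e = 2 then [] else [D 1 # zigzag (e - 3)]) @ map block mid @
                (if c = 1 then [] else [zigzag (c - 1)]))"
    using p unfolding bs by simp
  then show ?thesis using phi_stripped[of e mid c] alt(1) ec unfolding bs by simp
qed

section \<open>Admissible paths as concatenations of blocks\<close>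

lemma admissible_zigzag_append:
  "odd k \<Longrightarrow> h \<in> {-1, 0} \<Longrightarrow> admissible h (zigzag k @ q) \<longleftrightarrow> admissible (h + 1) q"
proof (induction k rule: zigzag.induct)
  case (3 k)
  then have "k > 0" by (auto intro: odd_pos)
  with 3 show ?case by (auto simp: hd_zigzag)
qed auto

text \<open>An odd block moves between heights 0 and 1. An even block first drops from 1 to -1 and
  then moves between -1 and 0. These are the two starting heights in
  \<open>admissible_zigzag_append\<close>.\<close>

lemma admissible_block_append:
  assumes "b > 0"
  shows "admissible (if odd b then 0 else 1) (block b @ q) \<longleftrightarrow>
           admissible (if odd b then 1 else 0) q"
  using assms admissible_zigzag_append[of b 0 q] admissible_zigzag_append[of "b - 1" "-1" q]
  by (auto simp: block_def hd_append hd_zigzag)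

text \<open>Each block ends at the height where a block of the other parity starts, and a final odd
  block ends at the required height 1.\<close>

lemma admissible_concat_block:
  assumes "parity_alternating bs" "bs \<noteq> []" "odd (last bs)"
  shows "admissible (if odd (hd bs) then 0 else 1) (concat (map block bs))"
  using assms
proof (induction bs rule: induct_list012)
  case (2 b)
  then show ?case
    using admissible_block_append[of b "[]"] by (auto simp: parity_alternating_def)
next
  case (3 b b' bs)
  then show ?case
    using admissible_block_append[of b "concat (map block (b' # bs))"]
    by (auto simp: parity_alternating_Cons split: if_splits)
qed auto

text \<open>Lets the first block grow from the front while a path is decoded.\<close>

lemma block_add_2:
  assumes "b > 0"
  shows "block (b + 2) = (if odd b then U # D 1 # block b else D 2 # U # D 1 # tl (block b))"
proof (cases b)
  case (Suc k)
  then show ?thesis by (simp add: block_def)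
qed (use assms in simp)

text \<open>The joint induction treats the suffixes beginning at a cut: before \<open>U\<close> at height 0, or
  before \<open>D\<^sub>2\<close> at height 1.\<close>

lemma admissible_imp_concat_block:
  "(hd q = U \<and> admissible 0 q \<or> hd q = D 2 \<and> admissible 1 q) \<Longrightarrow> q \<noteq> [] \<Longrightarrow>
    \<exists>bs. parity_alternating bs \<and> bs \<noteq> [] \<and> odd (last bs) \<and> (odd (hd bs) \<longleftrightarrow> hd q = U) \<and>
         q = concat (map block bs)"
proof (induction "length q" arbitrary: q rule: less_induct)
  case less
  \<comment> \<open>No cut near the front: dropping \<open>U, D 1\<close> from the front, or from
    behind the leading \<open>D 2\<close>, leaves a shorter suffix \<open>r'\<close> of the same
    kind, whose first block then grows by 2.\<close>
  have extend: ?case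
    if H: "hd q = U \<and> q = U # D 1 # r \<and> r' = r \<and> hd r = U \<and> admissible 0 r \<or>
        hd q = D 2 \<and> q = D 2 # U # D 1 # r \<and> r' = D 2 # r \<and> admissible 1 r'" "r \<noteq> []" for r r'
  proof -
    have "r' \<noteq> []" "length r' < length q" "hd r' = hd q" using H by auto
    then obtain bs where bs: "parity_alternating bs" "bs \<noteq> []" "odd (last bs)"
      "odd (hd bs) \<longleftrightarrow> hd q = U" "r' = concat (map block bs)"
      using less.hyps[of r'] H by auto
    then obtain b bs' where b: "bs = b # bs'" by (cases bs) auto
    have "block b \<noteq> []" "b > 0"
      using bs b length_block[of b] by (auto simp: parity_alternating_def)
    then have "q = concat (map block ((b + 2) # bs'))"
      using H bs unfolding b by (cases "block b") (auto simp: block_add_2 simp del: add_2_eq_Suc')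
    moreover have "parity_alternating ((b + 2) # bs')"
      using bs b by (auto simp: parity_alternating_Cons)
    ultimately show ?case
      using bs b by (intro exI[of _ "(b + 2) # bs'"]) auto
  qed
  \<comment> \<open>A cut after the first \<open>U\<close>: the block \<open>[U]\<close> or
    \<open>[D 2, U]\<close> is split off, and the rest begins with the other kind of block, so the
    parities alternate.\<close>
  have new: ?case
    if H: "hd q = U \<and> b = 1 \<and> hd r = D 2 \<and> admissible 1 r \<or> hd q = D 2 \<and> b = 2 \<and> hd r = U \<and> admissible 0 r"
      "q = block b @ r" "r \<noteq> []" for b r
  proof -
    have "length r < length q" using H by (auto simp: length_block)
    then obtain bs where "parity_alternating bs" "bs \<noteq> []" "odd (last bs)"
      "odd (hd bs) \<longleftrightarrow> hd r = U" "r = concat (map block bs)"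
      using less.hyps[of r] H by auto
    then show ?case
      using H by (intro exI[of _ "b # bs"]) (auto simp: parity_alternating_Cons)
  qed
  have D: "t = D 1 \<or> t = D 2" if "t \<noteq> U" "t \<noteq> D 0" "h + rise t \<in> {-1, 0, 1}" "h \<le> 1" for t h
    using that by (cases t) auto
  have height: "h \<in> {-1, 0, 1}" if "admissible h xs" for h xs
    using that by (cases xs) auto
  consider (up) q' where "q = U # q'" "admissible 0 q"
    | (down) q' where "q = D 2 # q'" "admissible 1 q"
    using less.prems by (cases q) auto
  then show ?case
  proof cases
    case up
    show ?thesis
    proof (cases q')
      case Nil
      then show ?thesis
        using up by (intro exI[of _ "[1]"]) (auto simp: parity_alternating_def block_def)
    next
      case (Cons t r)
      have ad: "admissible 1 (t # r)" using up Cons by simp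
      then have "1 + rise t \<in> {-1, 0, 1}" using height[of "1 + rise t" r] by simp
      moreover from this have "t \<noteq> U" by auto
      ultimately consider "t = D 1" | "t = D 2" using D[of t 1] ad by auto
      then show ?thesis
      proof cases
        case 1
        \<comment> \<open>\<open>D 1\<close> leads to height 0, whereas an admissible path ends at
          height 1.\<close>
        then have "r \<noteq> []" using ad by auto
        then show ?thesis using extend[of r r] up Cons 1 ad by auto
      next
        case 2
        then show ?thesis using new[of 1 "t # r"] up Cons ad by (auto simp: block_def)
      qed
    qed
  next
    case down
    then have "q' \<noteq> []" by auto
    then obtain r where r: "q = D 2 # U # r" using down by (cases q') auto
    have ad: "admissible 0 r" using down r by auto
    then obtain t r' where t: "r = t # r'" by (cases r) auto
    have "rise t \<in> {-1, 0, 1}" "t \<noteq> D 0" using height[of "rise t" r'] ad t by simp_all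
    moreover from this have "t \<noteq> D 2" by auto
    ultimately consider "t = U" | "t = D 1" using D[of t 0] unfolding add_0 by fastforce
    then show ?thesis
    proof cases
      case 1
      show ?thesis
      proof (rule new[of 2 r])
        show "q = block 2 @ r" by (simp add: r block_def)
      qed (use r t 1 ad in simp_all)
    next
      case 2
      show ?thesis
      proof (rule extend[of r' "D 2 # r'"])
        show "r' \<noteq> []" using ad t 2 by auto
      qed (use r t 2 ad in simp)
    qed
  qed
qed

section \<open>Band paths and their extensions\<close>

lemma ordinate_0 [simp]: "ordinate p 0 = 0"
  and ordinate_Cons_Suc [simp]: "ordinate (s # p) (Suc i) = rise s + ordinate p i"
  by (simp_all add: ordinate_def)

lemma all_le_Suc_iff: "(\<forall>i \<le> Suc n. P i) \<longleftrightarrow> P 0 \<and> (\<forall>i \<le> n. P (Suc i))"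
  by (metis Suc_le_mono le0 not0_implies_Suc)

text \<open>The appended \<open>U\<close> turns final height 0 into 1 and is a legal successor of
  any last step of \<open>p\<close>. The offset \<open>h\<close> is needed for the
  induction.\<close>

lemma admissible_append_U:
  "admissible h (p @ [U]) \<longleftrightarrow>
     (\<forall>k. D k \<in> set p \<longrightarrow> k \<ge> 1) \<and> successively (\<lambda>s t. \<not> (s \<noteq> U \<and> t \<noteq> U)) p \<and>
     h + ordinate p (length p) = 0 \<and> (\<forall>i \<le> length p. h + ordinate p i \<in> {-1, 0, 1})"
proof (induction p arbitrary: h)
  case (Cons s p)
  have "(\<forall>k. D k \<in> set (s # p) \<longrightarrow> k \<ge> 1) \<longleftrightarrow> s \<noteq> D 0 \<and> (\<forall>k. D k \<in> set p \<longrightarrow> k \<ge> 1)"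
    by (cases s) (auto simp: Suc_le_eq)
  moreover have "(s \<noteq> U \<longrightarrow> p @ [U] = [] \<or> hd (p @ [U]) = U) \<longleftrightarrow>
      (p = [] \<or> \<not> (s \<noteq> U \<and> hd p \<noteq> U))"
    by (cases p) auto
  moreover have "p = [] \<Longrightarrow> successively (\<lambda>s t. \<not> (s \<noteq> U \<and> t \<noteq> U)) p" by simp
  ultimately show ?case
    by (simp only: append_Cons admissible.simps Cons.IH successively_Cons list.size all_le_Suc_iff
        ordinate_0 ordinate_Cons_Suc add_0_right add_Suc_right add.assoc) blast
qed auto

text \<open>The prefix \<open>D 2, U\<close> visits 1 and -1 and reaches 0, all in the band; as it
  ends in \<open>U\<close>, it does not restrict the first step of \<open>p\<close>.\<close>

lemma gdap_band_iff:
  "p \<in> gdap_band n \<longleftrightarrow> length p = n \<and> admissible 1 (D 2 # U # p @ [U])"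
proof -
  have "admissible 1 (D 2 # U # p @ [U]) \<longleftrightarrow> admissible 0 (p @ [U])" by simp
  also have "\<dots> \<longleftrightarrow> gdap p \<and> (\<forall>i \<le> length p. ordinate p i \<in> {-1, 0, 1})"
    unfolding admissible_append_U gdap_def add_0 by blast
  finally show ?thesis unfolding gdap_band_def by blast
qed

section \<open>Correspondence with the compositions\<close>

lemma rev_in_alternating_compositions_iff:
  "rev bs \<in> alternating_compositions m \<longleftrightarrow>
     parity_alternating bs \<and> bs \<noteq> [] \<and> even (hd bs) \<and> odd (last bs) \<and> sum_list bs = m"
proof -
  have "successively (\<lambda>x y. even y \<noteq> even x) bs = successively (\<lambda>x y. even x \<noteq> even y) bs"
    by (rule arg_cong[of _ _ "\<lambda>P. successively P bs"]) auto
  then show ?thesis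
    unfolding alternating_compositions_def compositions_def parity_alternating_def
    by (auto simp only: mem_Collect_eq set_rev sum_list_rev rev_is_Nil_conv hd_rev last_rev
        successively_rev)
qed

lemma length_concat_block: "parity_alternating bs \<Longrightarrow> length (concat (map block bs)) = sum_list bs"
  using map_length_block[of bs] by (simp add: length_concat)

text \<open>All three facts concern the same \<open>bs\<close>: \<open>phi p\<close> determines
  \<open>bs\<close>, and \<open>bs\<close> determines the extended path and with it
  \<open>p\<close>, which yields injectivity.\<close>

lemma gdap_band_imp_lengths:
  assumes "p \<in> gdap_band n"
  shows "\<exists>bs. D 2 # U # p @ [U] = concat (map block bs) \<and> phi p = rev bs \<and>
              rev bs \<in> alternating_compositions (n + 3)"
proof -
  define q where "q = D 2 # U # p @ [U]"
  have "length q = n + 3" "admissible 1 q" using assms by (auto simp: gdap_band_iff q_def)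
  moreover from this obtain bs where bs: "parity_alternating bs" "bs \<noteq> []" "even (hd bs)"
    "odd (last bs)" "q = concat (map block bs)"
    using admissible_imp_concat_block[of q] by (auto simp: q_def)
  ultimately have "rev bs \<in> alternating_compositions (n + 3)"
    using length_concat_block[of bs] by (auto simp: rev_in_alternating_compositions_iff)
  then show ?thesis using bs phi_eq_rev[of bs p] unfolding q_def by blast
qed

lemma alternating_compositions_imp_path:
  assumes "rev bs \<in> alternating_compositions (n + 3)"
  shows "\<exists>p \<in> gdap_band n. phi p = rev bs"
proof -
  have bs: "parity_alternating bs" "bs \<noteq> []" "even (hd bs)" "odd (last bs)" "sum_list bs = n + 3"
    using assms by (auto simp: rev_in_alternating_compositions_iff)
  define q where "q = concat (map block bs)"
  have len: "length q = n + 3" using length_concat_block[OF bs(1)] bs(5) by (simp add: q_def)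
  obtain e m where em: "bs = e # m" using bs by (cases bs) auto
  have ad: "admissible 1 q" using admissible_concat_block[OF bs(1,2,4)] bs(3) by (simp add: q_def)
  have "hd q = D 2"
    using bs em by (auto simp: q_def block_def)
  then obtain q' where "q = D 2 # q'" using len by (cases q) auto
  \<comment> \<open>Only \<open>U\<close> may follow the leading \<open>D 2\<close>, and the length
    \<open>n + 3\<close> ensures that a step follows.\<close>
  with ad len obtain x where x: "q = D 2 # U # x" by (cases q') auto
  have "last q = U"
  proof -
    obtain m' c where "bs = m' @ [c]" using bs(2) by (cases bs rule: rev_cases) auto
    with bs show ?thesis
      by (auto simp: q_def last_block block_def last_append last_zigzag)
  qed
  \<comment> \<open>\<open>length x = n + 1\<close>, so the final \<open>U\<close> of
    \<open>q\<close> lies in \<open>x\<close>.\<close>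
  moreover have "x \<noteq> []" using len x by auto
  ultimately obtain p where "x = p @ [U]" using x by (cases x rule: rev_cases) auto
  with x len ad have "p \<in> gdap_band n" "D 2 # U # p @ [U] = concat (map block bs)"
    by (auto simp: gdap_band_iff q_def)
  then show ?thesis using phi_eq_rev[OF bs(1-4)] by blast
qed

theorem theorem7:
  fixes n :: nat
  shows "bij_betw phi (gdap_band n) (alternating_compositions (n + 3))"
proof (rule bij_betwI')
  fix p p' assume "p \<in> gdap_band n" "p' \<in> gdap_band n"
  then show "phi p = phi p' \<longleftrightarrow> p = p'"
    using gdap_band_imp_lengths[of p n] gdap_band_imp_lengths[of p' n]
    by (metis append_same_eq list.inject rev_rev_ident)
next
  fix p assume "p \<in> gdap_band n"
  then show "phi p \<in> alternating_compositions (n + 3)"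
    using gdap_band_imp_lengths by metis
next
  fix c assume "c \<in> alternating_compositions (n + 3)"
  then show "\<exists>p \<in> gdap_band n. c = phi p"
    using alternating_compositions_imp_path[of "rev c" n] by auto
qed

end
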